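(* For each $n\in N$ let $\mathcal{D}_n$ be a coherent set of desirable gambles on $\mathcal{X}_n$. Then $\otimes_{n\in N}\mathcal{D}_n$ is a coherent set of desirable gambles on $\mathcal{X}_N$.
   Context: Let $N$ be a finite non-empty index set, and for each $n\in N$ let $\mathcal{X}_n$ be a finite non-empty set. For $R\subseteq N$ let $\mathcal{X}_R:=\prod_{r\in R}\mathcal{X}_r$, with $\mathcal{X}_\emptyset$ a one-point set. For a finite non-empty set $\mathcal{Z}$, a gamble on $\mathcal{Z}$ is a function $\mathcal{Z}\to\mathbb{R}$; $\mathcal{G}(\mathcal{Z})$ is the linear space of all gambles on $\mathcal{Z}$. Write $f\geq g$ for pointwise inequality and $f>g$ if $f\geq g$ and $f\neq g$; $\mathcal{G}(\mathcal{Z})_{>0}:=\{f\in\mathcal{G}(\mathcal{Z}):f>0\}$. For $\mathcal{A}\subseteq\mathcal{G}(\mathcal{Z})$, $\mathrm{posi}(\mathcal{A}):=\{\sum_{k=1}^{m}\lambda_kf_k : m\geq 1,\ f_k\in\mathcal{A},\ \lambda_k>0\}$. A set of desirable gambles $\mathcal{D}\subseteq\mathcal{G}(\mathcal{Z})$ is coherent if (D1) $0\notin\mathcal{D}$; (D2) $\mathcal{G}(\mathcal{Z})_{>0}\subseteq\mathcal{D}$; (D3) $\mathrm{posi}(\mathcal{D})=\mathcal{D}$. For $R\subseteq N$, a gamble $f$ on $\mathcal{X}_R$ is identified with its cylindrical extension $x_N\mapsto f(x_R)$ on $\mathcal{X}_N$; $\mathbb{I}_{\{x_R\}}$ denotes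 the indicator of $x_R\in\mathcal{X}_R$ (identified in the same way with a gamble on $\mathcal{X}_N$). Define $$\otimes_{n\in N}\mathcal{D}_n:=\mathrm{posi}\Big(\mathcal{G}(\mathcal{X}_N)_{>0}\cup\bigcup_{n\in N}\mathrm{posi}\left(\{\mathbb{I}_{\{x_{N\setminus\{n\}}\}}g : g\in\mathcal{D}_n,\ x_{N\setminus\{n\}}\in\mathcal{X}_{N\setminus\{n\}}\}\right)\Big).$$ *)

theory Defs
  imports Complex_Main "HOL-Library.FuncSet" "HOL-Library.Indicator_Function"
begin

(* A gamble Z -> R is represented by its extension by 0 to the whole type, so that gambles on Z
   form a linear space under the plain pointwise operations, the pointwise order on Z is the
   order of the function type, and functional equality is equality on Z. *)
definition gambles :: "'z set \<Rightarrow> ('z \<Rightarrow> real) set" where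
  "gambles Z = {f. \<forall>z. z \<notin> Z \<longrightarrow> f z = 0}"

definition pos_gambles :: "'z set \<Rightarrow> ('z \<Rightarrow> real) set" where
  "pos_gambles Z = {f \<in> gambles Z. f \<ge> (\<lambda>_. 0) \<and> f \<noteq> (\<lambda>_. 0)}"

definition posi :: "('z \<Rightarrow> real) set \<Rightarrow> ('z \<Rightarrow> real) set" where
  "posi A = {\<lambda>z. \<Sum>k=1..m. c k * f k z | (m::nat) (c :: nat \<Rightarrow> real) f.
     m \<ge> 1 \<and> (\<forall>k\<in>{1..m}. f k \<in> A \<and> c k > 0)}"

definition coherent :: "'z set \<Rightarrow> ('z \<Rightarrow> real) set \<Rightarrow> bool" where
  "coherent Z D \<longleftrightarrow>
     D \<subseteq> gambles Z \<and> (\<lambda>_. 0) \<notin> D \<and> pos_gambles Z \<subseteq> D \<and> posi D = D"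

(* The product over R of the sets X r is the library's PiE R X; for R = {} it is a singleton.
   Values outside PiE N X are 0, as required of gambles on PiE N X. *)
definition cyl_ext :: "'i set \<Rightarrow> ('i \<Rightarrow> 'a set) \<Rightarrow> 'i set \<Rightarrow> (('i \<Rightarrow> 'a) \<Rightarrow> real) \<Rightarrow>
    ('i \<Rightarrow> 'a) \<Rightarrow> real" where
  "cyl_ext N X R f = (\<lambda>x. if x \<in> PiE N X then f (restrict x R) else 0)"

(* The cylindrical extension for R = {n}, where a gamble on PiE {n} X is taken as one on X n. *)
definition cyl_ext1 :: "'i set \<Rightarrow> ('i \<Rightarrow> 'a set) \<Rightarrow> 'i \<Rightarrow> ('a \<Rightarrow> real) \<Rightarrow>
    ('i \<Rightarrow> 'a) \<Rightarrow> real" where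
  "cyl_ext1 N X n g = (\<lambda>x. if x \<in> PiE N X then g (x n) else 0)"

definition indep_prod :: "'i set \<Rightarrow> ('i \<Rightarrow> 'a set) \<Rightarrow> ('i \<Rightarrow> ('a \<Rightarrow> real) set) \<Rightarrow>
    (('i \<Rightarrow> 'a) \<Rightarrow> real) set" where
  "indep_prod N X D =
     posi (pos_gambles (PiE N X) \<union>
       (\<Union>n\<in>N. posi {\<lambda>x. cyl_ext N X (N - {n}) (indicator {y}) x * cyl_ext1 N X n g x | g y.
                        g \<in> D n \<and> y \<in> PiE (N - {n}) X}))"

end

theory Submission
  imports Defs
begin

text \<open>
  The only substantial point is that 0 is not in the product. A combination of generators that
  equals 0 involves only finitely many gambles from each \<open>D n\<close>. By Fourier--Motzkin elimination
  there is a strictly positive weight on \<open>X n\<close> that gives all of these gambles a positive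
  expectation. The product of these weights then gives a positive expectation to every generator
  in the combination, hence to 0, which is absurd.
\<close>

section \<open>Convex cones and positive hulls\<close>

text \<open>Scalars are strictly positive and 0 need not be a member, so that coherent sets and open
  half-spaces of gambles both qualify.\<close>

definition convex_cone_set :: "('z \<Rightarrow> real) set \<Rightarrow> bool" where
  "convex_cone_set C \<longleftrightarrow>
     (\<forall>f\<in>C. \<forall>g\<in>C. (\<lambda>z. f z + g z) \<in> C) \<and> (\<forall>c>0. \<forall>f\<in>C. (\<lambda>z. c * f z) \<in> C)"

lemma convex_cone_setD:
  assumes "convex_cone_set C"
  shows "f \<in> C \<Longrightarrow> g \<in> C \<Longrightarrow> (\<lambda>z. f z + g z) \<in> C"
    and "c > 0 \<Longrightarrow> f \<in> C \<Longrightarrow> (\<lambda>z. c * f z) \<in> C"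
  using assms by (auto simp: convex_cone_set_def)

lemma posiI:
  fixes m :: nat
  assumes "m \<ge> 1" and "\<And>k. k \<in> {1..m} \<Longrightarrow> u k \<in> A" and "\<And>k. k \<in> {1..m} \<Longrightarrow> c k > 0"
  shows "(\<lambda>z. \<Sum>k=1..m. c k * u k z) \<in> posi A"
  unfolding posi_def using assms
  by (intro CollectI exI[of _ m] exI[of _ c] exI[of _ u]) auto

lemma posiE:
  assumes "f \<in> posi A"
  obtains c u and m :: nat where "f = (\<lambda>z. \<Sum>k=1..m. c k * u k z)" "m \<ge> 1"
    "\<forall>k\<in>{1..m}. u k \<in> A \<and> c k > 0"
  using assms unfolding posi_def by (elim CollectE exE conjE) blast

lemma posi_superset: "A \<subseteq> posi A"
proof
  fix f assume "f \<in> A"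
  then show "f \<in> posi A"
    using posiI[of 1 "\<lambda>_. f" A "\<lambda>_. 1"] by simp
qed

lemma posi_mono: "A \<subseteq> B \<Longrightarrow> posi A \<subseteq> posi B"
  unfolding posi_def by blast

lemma convex_cone_set_posi: "convex_cone_set (posi A)"
  unfolding convex_cone_set_def
proof (intro conjI ballI allI impI)
  fix f g assume "f \<in> posi A" "g \<in> posi A"
  from \<open>f \<in> posi A\<close> obtain c u and m :: nat where
    f: "f = (\<lambda>z. \<Sum>k=1..m. c k * u k z)" "m \<ge> 1"
      "\<forall>k\<in>{1..m}. u k \<in> A \<and> c k > 0" by (rule posiE)
  from \<open>g \<in> posi A\<close> obtain c' u' and m' :: nat where
    g: "g = (\<lambda>z. \<Sum>k=1..m'. c' k * u' k z)" "m' \<ge> 1"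
      "\<forall>k\<in>{1..m'}. u' k \<in> A \<and> c' k > 0" by (rule posiE)
  \<comment> \<open>The two combinations are concatenated: indices up to \<open>m\<close> carry the
    one for \<open>f\<close>, the following \<open>m'\<close> indices, shifted by \<open>m\<close>,
    the one for \<open>g\<close>.\<close>
  define d where "d k = (if k \<le> m then c k else c' (k - m))" for k
  define v where "v k = (if k \<le> m then u k else u' (k - m))" for k
  have eq: "(\<Sum>k=1..m+m'. d k * v k z) = f z + g z" for z
  proof -
    have "(\<Sum>k=1..m+m'. d k * v k z) =
        (\<Sum>k=1..m. d k * v k z) + (\<Sum>k=1+m..m'+m. d k * v k z)"
      by (subst sum.ub_add_nat) (auto simp: add.commute)
    also have "(\<Sum>k=1+m..m'+m. d k * v k z) = g z"
      unfolding g sum.shift_bounds_cl_nat_ivl by (intro sum.cong) (auto simp: d_def v_def)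
    also have "(\<Sum>k=1..m. d k * v k z) = f z"
      unfolding f by (intro sum.cong) (auto simp: d_def v_def)
    finally show ?thesis .
  qed
  have "v k \<in> A" "d k > 0" if "k \<in> {1..m+m'}" for k
  proof -
    have "k - m \<in> {1..m'}" if "\<not> k \<le> m"
      using that \<open>k \<in> {1..m+m'}\<close> by auto
    then show "v k \<in> A" "d k > 0"
      using that f(3) g(3) by (auto simp: d_def v_def)
  qed
  then have "(\<lambda>z. \<Sum>k=1..m+m'. d k * v k z) \<in> posi A"
    using f(2) by (intro posiI) auto
  then show "(\<lambda>z. f z + g z) \<in> posi A"
    unfolding eq .
next
  fix c :: real and f assume "c > 0" "f \<in> posi A"
  from \<open>f \<in> posi A\<close> obtain d u and m :: nat where
    f: "f = (\<lambda>z. \<Sum>k=1..m. d k * u k z)" "m \<ge> 1"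
      "\<forall>k\<in>{1..m}. u k \<in> A \<and> d k > 0" by (rule posiE)
  then have "(\<lambda>z. \<Sum>k=1..m. (c * d k) * u k z) \<in> posi A"
    using \<open>c > 0\<close> by (intro posiI) auto
  then show "(\<lambda>z. c * f z) \<in> posi A"
    unfolding f(1) by (simp add: sum_distrib_left mult.assoc)
qed

text \<open>Induction on the number of summands, starting at 1 because \<open>C\<close> may omit 0.
  Inclusions of \<open>posi A\<close> in a cone can thus be checked on the generators alone.\<close>

lemma posi_least:
  assumes C: "convex_cone_set C" and "A \<subseteq> C"
  shows "posi A \<subseteq> C"
proof
  fix f assume "f \<in> posi A"
  then obtain c u and m :: nat where
    f: "f = (\<lambda>z. \<Sum>k=1..m. c k * u k z)" "m \<ge> 1"
      "\<forall>k\<in>{1..m}. u k \<in> A \<and> c k > 0" by (rule posiE)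
  have "(\<lambda>z. \<Sum>k=1..m. c k * u k z) \<in> C"
    using f(2,3)
  proof (induction m rule: dec_induct)
    case base
    then show ?case using assms(2) by (auto intro!: convex_cone_setD(2)[OF C])
  next
    case (step m)
    then have "(\<lambda>z. \<Sum>k=1..m. c k * u k z) \<in> C" and "(\<lambda>z. c (Suc m) * u (Suc m) z) \<in> C"
      using assms(2) by (auto intro!: convex_cone_setD(2)[OF C])
    from convex_cone_setD(1)[OF C this] show ?case by simp
  qed
  then show "f \<in> C" using f(1) by simp
qed

lemma posi_posi: "posi (posi A) = posi A"
  by (simp add: convex_cone_set_posi posi_least posi_superset subset_antisym)

text \<open>One combination uses only finitely many gambles. This passage to finite sets is what
  makes elimination applicable.\<close>

lemma posi_finite_subset:
  assumes "f \<in> posi A"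
  obtains B where "finite B" "B \<subseteq> A" "f \<in> posi B"
  using assms
proof (rule posiE)
  fix c u and m :: nat
  assume f: "f = (\<lambda>z. \<Sum>k=1..m. c k * u k z)" "m \<ge> 1"
    "\<forall>k\<in>{1..m}. u k \<in> A \<and> c k > 0"
  have "f \<in> posi (u ` {1..m})"
    unfolding f(1) using f(2,3) by (intro posiI) auto
  then show ?thesis using f(3) by (intro that[of "u ` {1..m}"]) auto
qed

section \<open>Positive expectations\<close>

text \<open>The gambles with positive expectation form a convex cone. Since 0 has expectation 0, a
  weight that is positive on \<open>A\<close> certifies that 0 is not in
  \<open>posi A\<close>.\<close>

lemma posi_pos_expectation:
  fixes w :: "'z \<Rightarrow> real"
  assumes "\<And>f. f \<in> A \<Longrightarrow> (\<Sum>z\<in>Z. w z * f z) > 0" and "f \<in> posi A"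
  shows "(\<Sum>z\<in>Z. w z * f z) > 0"
proof -
  have "convex_cone_set {f. (\<Sum>z\<in>Z. w z * f z) > 0}"
    unfolding convex_cone_set_def
    by (auto simp: distrib_left sum.distrib mult.left_commute[of "w _"] sum_distrib_left[symmetric])
  from posi_least[OF this, of A] assms show ?thesis by auto
qed

lemma convex_cone_set_gambles: "convex_cone_set (gambles Z)"
  by (auto simp: convex_cone_set_def gambles_def)

lemma pos_gambles_expectation:
  assumes "finite Z" and "\<And>z. z \<in> Z \<Longrightarrow> w z > 0" and "f \<in> pos_gambles Z"
  shows "(\<Sum>z\<in>Z. w z * f z) > 0"
proof -
  obtain z where z: "f z \<noteq> 0" using assms(3) by (auto simp: pos_gambles_def)
  have ge: "f x \<ge> 0" for x using assms(3) by (auto simp: pos_gambles_def le_fun_def)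
  have "z \<in> Z" using z assms(3) by (auto simp: pos_gambles_def gambles_def)
  moreover have "f z > 0" using z ge[of z] by simp
  ultimately show ?thesis
    using assms ge by (intro sum_pos2[of Z z]) (auto simp: less_imp_le)
qed

section \<open>Fourier--Motzkin elimination\<close>

text \<open>Any point between \<open>Max L\<close> and \<open>Min U\<close> works; if one set is
  empty, only bounds from one side can remain. The point found serves as the weight of an eliminated
  outcome.\<close>

lemma finite_separation_between:
  fixes L U :: "real set"
  assumes "finite L" "finite U" and "\<And>l u. l \<in> L \<Longrightarrow> u \<in> U \<Longrightarrow> l < u"
  obtains t where "\<And>l. l \<in> L \<Longrightarrow> l < t" "\<And>u. u \<in> U \<Longrightarrow> t < u"
proof (cases "L = {} \<or> U = {}")
  case True
  have "\<exists>t. \<forall>l\<in>L. l < t"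
    using Max_ge[OF assms(1)] by (intro exI[of _ "Max L + 1"]) force
  moreover have "\<exists>t. \<forall>u\<in>U. t < u"
    using Min_le[OF assms(2)] by (intro exI[of _ "Min U - 1"]) force
  ultimately show ?thesis using True that by (metis empty_iff)
next
  case False
  then have "Max L < Min U" using assms(1,2) by (intro assms(3)) auto
  then obtain t where "Max L < t" "t < Min U" using dense by blast
  with False assms(1,2) show ?thesis by (intro that[of t]) auto
qed

text \<open>The induction on \<open>Z\<close> eliminates the weight of one point at a time; the gambles produced by
  eliminating \<open>z\<close> vanish at \<open>z\<close> and remain in the cone.\<close>

lemma finite_subset_pos_weight:
  assumes "finite Z" and C: "convex_cone_set C" and "(\<lambda>_. 0) \<notin> C"
    and "finite F" and "F \<subseteq> C" and "F \<subseteq> gambles Z"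
  shows "\<exists>w. \<forall>f\<in>F. (\<Sum>z\<in>Z. w z * f z) > 0"
  using assms(1,4-6)
proof (induction Z arbitrary: F rule: finite_induct)
  case empty
  \<comment> \<open>On the empty set 0 is the only gamble, and it is not in \<open>C\<close>; hence
    \<open>F\<close> is empty.\<close>
  then have "F \<subseteq> {\<lambda>_. 0}" by (auto simp: gambles_def)
  with empty assms(3) show ?case by auto
next
  case (insert z Z)
  define P where "P = {f \<in> F. f z > 0}"
  define M where "M = {f \<in> F. f z < 0}"
  \<comment> \<open>The factors normalise the values at \<open>z\<close> to 1 and -1, so that they
    cancel. Both factors are positive for \<open>f\<close> in \<open>P\<close> and \<open>g\<close>
    in \<open>M\<close>, which keeps \<open>h f g\<close> in the cone.\<close>
  define h where "h f g x = (1 / f z) * f x + (1 / (- g z)) * g x" for f g :: "'a \<Rightarrow> real" and x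
  define F' where "F' = {f \<in> F. f z = 0} \<union> (\<lambda>(f, g). h f g) ` (P \<times> M)"
  have fin: "finite F'" using insert.prems by (auto simp: F'_def P_def M_def)
  have "h f g \<in> C" if "f \<in> P" "g \<in> M" for f g
    unfolding h_def using that insert.prems
    by (intro convex_cone_setD[OF C]) (auto simp: P_def M_def)
  then have F'C: "F' \<subseteq> C" using insert.prems by (auto simp: F'_def)
  have "h f g \<in> gambles Z" if "f \<in> P" "g \<in> M" for f g
  proof -
    have "f \<in> gambles (insert z Z)" "g \<in> gambles (insert z Z)" "f z > 0" "g z < 0"
      using that insert.prems(3) by (auto simp: P_def M_def)
    then have "h f g x = 0" if "x \<notin> Z" for x
      using that by (cases "x = z") (auto simp: h_def gambles_def)
    then show ?thesis by (simp add: gambles_def)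
  qed
  moreover have "f \<in> gambles Z" if "f \<in> F" "f z = 0" for f
    using that insert.prems(3) unfolding gambles_def by fastforce
  ultimately have "F' \<subseteq> gambles Z"
    by (auto simp: F'_def)
  with fin F'C obtain w where w: "\<And>f. f \<in> F' \<Longrightarrow> (\<Sum>x\<in>Z. w x * f x) > 0"
    using insert.IH[OF fin] by blast
  define E where "E f = (\<Sum>x\<in>Z. w x * f x)" for f
  \<comment> \<open>A weight \<open>t\<close> at \<open>z\<close> must satisfy
    \<open>t * f z + E f > 0\<close>: a lower bound on \<open>t\<close> for each gamble in
    \<open>P\<close>, an upper bound for each in \<open>M\<close>. That the bounds are compatible is
    exactly \<open>E (h f g) > 0\<close>.\<close>
  have "- E f / f z < E g / - g z" if "f \<in> P" "g \<in> M" for f g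
  proof -
    have "E (h f g) > 0" using w[of "h f g"] that by (force simp: F'_def E_def)
    moreover have "E (h f g) = (1 / f z) * E f + (1 / (- g z)) * E g"
      unfolding E_def h_def
      by (simp only: distrib_left mult.left_commute[of "w _"] sum.distrib sum_distrib_left)
    ultimately show ?thesis by simp
  qed
  then have lu: "l < u" if "l \<in> (\<lambda>f. - E f / f z) ` P" "u \<in> (\<lambda>g. E g / - g z) ` M" for l u
    using that by blast
  have "finite P" "finite M" using insert.prems(1) by (auto simp: P_def M_def)
  from finite_separation_between[OF this[THEN finite_imageI] lu]
  obtain t where t_image: "\<And>l. l \<in> (\<lambda>f. - E f / f z) ` P \<Longrightarrow> l < t"
      "\<And>u. u \<in> (\<lambda>g. E g / - g z) ` M \<Longrightarrow> t < u"
    by blast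
  have t: "\<And>f. f \<in> P \<Longrightarrow> - E f / f z < t" "\<And>g. g \<in> M \<Longrightarrow> t < E g / - g z"
    using t_image by blast+
  have "(\<Sum>x\<in>insert z Z. (w(z := t)) x * f x) > 0" if "f \<in> F" for f
  proof -
    have "(\<Sum>x\<in>Z. (w(z := t)) x * f x) = E f"
      unfolding E_def using insert.hyps by (intro sum.cong) auto
    then have "(\<Sum>x\<in>insert z Z. (w(z := t)) x * f x) = t * f z + E f"
      using insert.hyps by simp
    also have "\<dots> > 0"
    proof (cases "f z" "0 :: real" rule: linorder_cases)
      case less
      then show ?thesis using t(2)[of f] that by (simp add: M_def field_simps)
    next
      case equal
      then show ?thesis using w[of f] that by (simp add: F'_def E_def)
    next
      case greater
      then show ?thesis using t(1)[of f] that by (simp add: P_def field_simps)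
    qed
    finally show ?thesis .
  qed
  then show ?case by blast
qed

text \<open>Strict positivity of the weight comes from adding the indicators of all points to
  \<open>F\<close>: they lie in \<open>D\<close> by coherence, and the expectation of
  \<open>indicator {z}\<close> is \<open>w z\<close>.\<close>

lemma coherent_finite_pos_weight:
  assumes "finite Z" and D: "coherent Z D" and "finite F" and "F \<subseteq> D"
  obtains w where "\<And>z. z \<in> Z \<Longrightarrow> w z > 0" and "\<And>f. f \<in> F \<Longrightarrow> (\<Sum>z\<in>Z. w z * f z) > 0"
proof -
  define I where "I = (\<lambda>z. indicator {z} :: _ \<Rightarrow> real) ` Z"
  have "I \<subseteq> pos_gambles Z"
  proof
    fix f assume "f \<in> I"
    then obtain z where z: "z \<in> Z" "f = indicator {z}" by (auto simp: I_def)
    then have "f z \<noteq> 0" by simp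
    then have "f \<noteq> (\<lambda>_. 0)" by metis
    with z show "f \<in> pos_gambles Z"
      by (auto simp: pos_gambles_def gambles_def le_fun_def indicator_def)
  qed
  then have FI: "F \<union> I \<subseteq> D" using assms by (auto simp: coherent_def)
  moreover have "F \<union> I \<subseteq> gambles Z" using FI D unfolding coherent_def by blast
  moreover have "convex_cone_set D"
    using convex_cone_set_posi[of D] D by (simp add: coherent_def)
  moreover have "finite (F \<union> I)" "(\<lambda>_. 0) \<notin> D"
    using assms by (auto simp: I_def coherent_def)
  ultimately obtain w where w: "\<And>f. f \<in> F \<union> I \<Longrightarrow> (\<Sum>z\<in>Z. w z * f z) > 0"
    using finite_subset_pos_weight[OF assms(1), of D "F \<union> I"] by blast
  have "w z > 0" if "z \<in> Z" for z
  proof -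
    have "(\<Sum>x\<in>Z. w x * indicator {z} x) = w z"
      using assms(1) that by (simp add: indicator_def)
    then show ?thesis using w[of "indicator {z}"] that by (simp add: I_def)
  qed
  with w that show ?thesis by blast
qed

section \<open>Product weights\<close>

text \<open>The indicator confines the sum to the points \<open>y(n := a)\<close>, and there the
  product weight splits into a factor independent of \<open>a\<close> and \<open>w n a\<close>. With
  positive weights, the sign is that of the marginal expectation of \<open>g\<close>.\<close>

lemma prod_weight_cyl_ext:
  fixes w :: "'i \<Rightarrow> 'a \<Rightarrow> real"
  assumes "finite N" and "\<And>n. n \<in> N \<Longrightarrow> finite (X n)" and "n \<in> N" and y: "y \<in> PiE (N - {n}) X"
  shows "(\<Sum>x\<in>PiE N X. (\<Prod>m\<in>N. w m (x m)) *
            (cyl_ext N X (N - {n}) (indicator {y}) x * cyl_ext1 N X n g x)) =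
         (\<Prod>m\<in>N - {n}. w m (y m)) * (\<Sum>a\<in>X n. w n a * g a)"
    (is "sum ?f _ = _")
proof -
  have upd: "y(n := a) \<in> PiE N X" "restrict (y(n := a)) (N - {n}) = y" if "a \<in> X n" for a
    using y that \<open>n \<in> N\<close> by (auto simp: PiE_iff extensional_def restrict_def fun_eq_iff)
  have "sum ?f (PiE N X) = sum ?f ((\<lambda>a. y(n := a)) ` X n)"
  proof (rule sum.mono_neutral_right)
    show "finite (PiE N X)" using assms by (auto intro: finite_PiE)
    show "(\<lambda>a. y(n := a)) ` X n \<subseteq> PiE N X" using upd by auto
    have "x \<in> (\<lambda>a. y(n := a)) ` X n" if "x \<in> PiE N X" "restrict x (N - {n}) = y" for x
    proof
      \<comment> \<open>This holds as an equality of total functions because \<open>x\<close> and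
        \<open>y\<close> are both \<open>undefined\<close> outside \<open>N\<close>.\<close>
      show "x = y(n := x n)" using that
        by (fastforce simp: fun_eq_iff PiE_iff extensional_def restrict_def split: if_splits)
      show "x n \<in> X n" using that \<open>n \<in> N\<close> by auto
    qed
    then show "\<forall>x\<in>PiE N X - (\<lambda>a. y(n := a)) ` X n. ?f x = 0"
      by (auto simp: cyl_ext_def indicator_def)
  qed
  also have "\<dots> = (\<Sum>a\<in>X n. ?f (y(n := a)))"
    by (subst sum.reindex) (auto simp: inj_on_def fun_eq_iff o_def split: if_splits)
  also have "\<dots> = (\<Sum>a\<in>X n. (\<Prod>m\<in>N - {n}. w m (y m)) * (w n a * g a))"
  proof (rule sum.cong)
    fix a assume a: "a \<in> X n"
    have "(\<Prod>m\<in>N. w m ((y(n := a)) m)) = w n a * (\<Prod>m\<in>N - {n}. w m (y m))"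
      using prod.remove[OF assms(1,3), of "\<lambda>m. w m ((y(n := a)) m)"] by simp
    then show "?f (y(n := a)) = (\<Prod>m\<in>N - {n}. w m (y m)) * (w n a * g a)"
      using upd[OF a] by (simp add: cyl_ext_def cyl_ext1_def)
  qed simp
  finally show ?thesis by (simp add: sum_distrib_left)
qed

section \<open>Coherence of the independent product\<close>

theorem proposition15:
  fixes N :: "'i set" and X :: "'i \<Rightarrow> 'a set" and D :: "'i \<Rightarrow> ('a \<Rightarrow> real) set"
  assumes "finite N" and "N \<noteq> {}"
    and "\<And>n. n \<in> N \<Longrightarrow> finite (X n)" and "\<And>n. n \<in> N \<Longrightarrow> X n \<noteq> {}"
    and "\<And>n. n \<in> N \<Longrightarrow> coherent (X n) (D n)"
  shows "coherent (PiE N X) (indep_prod N X D)"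
proof -
  define e where "e n g y x = cyl_ext N X (N - {n}) (indicator {y}) x * cyl_ext1 N X n g x"
    for n g y x
  define B where "B n = {e n g y | g y. g \<in> D n \<and> y \<in> PiE (N - {n}) X}" for n
  \<comment> \<open>\<open>posi ?G\<close> is a convex cone that contains every inner hull, so each
    element of the product is a single combination of gambles from \<open>?G\<close>.\<close>
  let ?G = "pos_gambles (PiE N X) \<union> (\<Union>n\<in>N. B n)"
  have prod_eq: "indep_prod N X D = posi (pos_gambles (PiE N X) \<union> (\<Union>n\<in>N. posi (B n)))"
    by (simp add: indep_prod_def B_def e_def[abs_def])
  have "posi (B n) \<subseteq> posi ?G" if "n \<in> N" for n
    using that by (intro posi_mono) auto
  then have "pos_gambles (PiE N X) \<union> (\<Union>n\<in>N. posi (B n)) \<subseteq> posi ?G"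
    using posi_superset[of ?G] by blast
  then have sub: "indep_prod N X D \<subseteq> posi ?G"
    unfolding prod_eq by (rule posi_least[OF convex_cone_set_posi])
  have "e n g y \<in> gambles (PiE N X)" for n g y
    by (simp add: e_def gambles_def cyl_ext_def)
  then have "?G \<subseteq> gambles (PiE N X)"
    unfolding B_def pos_gambles_def by blast
  then have "indep_prod N X D \<subseteq> gambles (PiE N X)"
    by (rule order_trans[OF sub posi_least[OF convex_cone_set_gambles]])
  moreover have "(\<lambda>_. 0) \<notin> indep_prod N X D"
  proof
    assume "(\<lambda>_. 0) \<in> indep_prod N X D"
    then obtain A where A: "finite A" "A \<subseteq> ?G" "(\<lambda>_. 0) \<in> posi A"
      by (rule posi_finite_subset[OF subsetD[OF sub]])
    have "\<exists>h. \<exists>n\<in>N. \<exists>y\<in>PiE (N - {n}) X. h \<in> D n \<and> f = e n h y"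
      if f: "f \<in> A - pos_gambles (PiE N X)" for f
    proof -
      obtain n where "n \<in> N" "f \<in> B n" using A(2) f by blast
      then show ?thesis unfolding B_def by blast
    qed
    then obtain g where g: "\<And>f. f \<in> A - pos_gambles (PiE N X) \<Longrightarrow>
        \<exists>n\<in>N. \<exists>y\<in>PiE (N - {n}) X. g f \<in> D n \<and> f = e n (g f) y"
      by metis
    have "\<exists>w. (\<forall>a\<in>X n. w a > 0) \<and> (\<forall>h\<in>g ` A \<inter> D n. (\<Sum>a\<in>X n. w a * h a) > 0)"
      if "n \<in> N" for n
    proof -
      have "finite (g ` A \<inter> D n)" "g ` A \<inter> D n \<subseteq> D n" using A(1) by auto
      from coherent_finite_pos_weight[OF assms(3)[OF that] assms(5)[OF that] this]
      show ?thesis by metis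
    qed
    then have "\<forall>n\<in>N. \<exists>w. (\<forall>a\<in>X n. w a > 0) \<and> (\<forall>h\<in>g ` A \<inter> D n. (\<Sum>a\<in>X n. w a * h a) > 0)"
      by blast
    from bchoice[OF this] obtain w where w: "\<And>n a. n \<in> N \<Longrightarrow> a \<in> X n \<Longrightarrow> w n a > 0"
      and wg: "\<And>n h. n \<in> N \<Longrightarrow> h \<in> g ` A \<inter> D n \<Longrightarrow> (\<Sum>a\<in>X n. w n a * h a) > 0"
      by blast
    have "(\<Sum>x\<in>PiE N X. (\<Prod>m\<in>N. w m (x m)) * f x) > 0" if f: "f \<in> A" for f
    proof (cases "f \<in> pos_gambles (PiE N X)")
      case True
      show ?thesis
      proof (rule pos_gambles_expectation[OF _ _ True])
        show "finite (PiE N X)" using assms(1,3) by (rule finite_PiE)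
        show "(\<Prod>m\<in>N. w m (x m)) > 0" if "x \<in> PiE N X" for x
          using w PiE_mem[OF that] by (intro prod_pos) blast
      qed
    next
      case False
      then obtain n y h where n: "n \<in> N" "y \<in> PiE (N - {n}) X"
        and h: "h \<in> g ` A \<inter> D n" "f = e n h y"
        using g[of f] f by blast
      have "(\<Sum>x\<in>PiE N X. (\<Prod>m\<in>N. w m (x m)) * f x) =
          (\<Prod>m\<in>N - {n}. w m (y m)) * (\<Sum>a\<in>X n. w n a * h a)"
        using prod_weight_cyl_ext[OF assms(1,3) n(1,2), of w h] by (simp add: h(2) e_def)
      also have "\<dots> > 0"
        using w PiE_mem[OF n(2)] wg[OF n(1) h(1)] by (intro mult_pos_pos prod_pos) blast+
      finally show ?thesis .
    qed
    \<comment> \<open>The product weight would give the zero gamble a positive expectation.\<close>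
    from posi_pos_expectation[OF this A(3)] show False by simp
  qed
  moreover have "pos_gambles (PiE N X) \<subseteq> indep_prod N X D"
    unfolding prod_eq using posi_superset by blast
  moreover have "posi (indep_prod N X D) = indep_prod N X D"
    unfolding prod_eq by (rule posi_posi)
  ultimately show ?thesis by (simp add: coherent_def)
qed

end
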